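(* Let $\mathcal H$ be a Hilbert space, let $\{f_k\}_{k\in\mathbb Z}=\{T^kf_0\}_{k\in\mathbb Z}$ be a frame for $\mathcal H$, and let $\{g_k\}_{k\in\mathbb Z}$ be a sequence in $\mathcal H$. Assume that there exist constants $\lambda_1,\lambda_2\in[0,1[$ such that $$\left\|\sum c_k(f_k-g_k)\right\|\le\lambda_1\left\|\sum c_kf_k\right\|+\lambda_2\left\|\sum c_kg_k\right\|$$ for all finite scalar sequences $\{c_k\}$. Then $\{g_k\}_{k\in\mathbb Z}$ is a frame for $\mathcal H$; furthermore, $\{g_k\}_{k\in\mathbb Z}$ can be represented as $\{g_k\}_{k\in\mathbb Z}=\{V^kg_0\}_{k\in\mathbb Z}$ for a linear operator $V:\operatorname{span}\{g_k\}_{k\in\mathbb Z}\to\operatorname{span}\{g_k\}_{k\in\mathbb Z}$. If $T$ is bounded, then $V$ is also bounded.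
   Context: A sequence $\{f_k\}_{k\in\mathbb Z}$ is a frame for $\mathcal H$ if there are $A,B>0$ with $A\|f\|^2\le\sum_{k}|\langle f,f_k\rangle|^2\le B\|f\|^2$ for all $f\in\mathcal H$. Here $\operatorname{span}$ denotes finite linear combinations (not closed). Writing $\{f_k\}_{k\in\mathbb Z}=\{T^kf_0\}_{k\in\mathbb Z}$ means that $T:\operatorname{span}\{f_k\}_{k\in\mathbb Z}\to\operatorname{span}\{f_k\}_{k\in\mathbb Z}$ is a (not necessarily bounded) bijective linear operator with $f_k=T^kf_0$ for all $k\in\mathbb Z$, where $T^k:=(T^{-1})^{-k}$ for $k<0$; and similarly for $\{g_k\}_{k\in\mathbb Z}=\{V^kg_0\}_{k\in\mathbb Z}$. *)

theory Defs
  imports "HOL-Analysis.Analysis"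
begin

text \<open>
  The scalars of a Hilbert space are the real or the complex numbers. The following class treats
  both at once; lemma \<open>rc_scalar_cases\<close> below shows that it has no other members.
\<close>

class rc_scalar = real_normed_field +
  fixes conj :: "'a \<Rightarrow> 'a"
  assumes conj_add: "conj (x + y) = conj x + conj y"
    and conj_mult: "conj (x * y) = conj x * conj y"
    and mult_conj_scaleR: "x * conj x = ((norm x)\<^sup>2) *\<^sub>R 1"

lemma mult_conj: "x * conj x = of_real ((norm x)\<^sup>2)" for x :: "'a::rc_scalar"
  by (simp add: mult_conj_scaleR of_real_def)

instantiation real :: rc_scalar
begin
definition conj_real :: "real \<Rightarrow> real" where "conj_real x = x"
instance by standard (simp_all add: conj_real_def power2_eq_square)
end

instantiation complex :: rc_scalar
begin
definition conj_complex :: "complex \<Rightarrow> complex" where "conj_complex = cnj"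
instance by standard (simp_all add: conj_complex_def complex_norm_square scaleR_conv_of_real del: of_real_power)
end

lemma rc_scalar_decompose:
  fixes x :: "'k::rc_scalar"
  obtains a y where "x = of_real a + y" "y * y = - of_real ((norm y)\<^sup>2)"
proof -
  have conj_real: "conj (of_real r :: 'k) = of_real r" if "r \<noteq> 0" for r
    using mult_conj[of "of_real r :: 'k"] that by (simp add: power2_eq_square)
  have "(1 + x) * (1 + conj x) = of_real ((norm (1 + x))\<^sup>2)"
    using mult_conj[of "1 + x"] conj_add[of 1 x] conj_real[of 1] by simp
  then have "x + conj x = of_real ((norm (1 + x))\<^sup>2 - 1 - (norm x)\<^sup>2)"
    using mult_conj[of x] by (simp add: algebra_simps)
  then obtain s where s: "x + conj x = of_real s" by blast
  define a where "a = s / 2"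
  define y where "y = x - of_real a"
  have x: "x = of_real a + y" by (simp add: y_def)
  have "conj y = - y"
  proof (cases "a = 0")
    case True
    then have "s = 0" "y = x" by (simp_all add: a_def y_def)
    then show ?thesis using s by (simp add: eq_neg_iff_add_eq_0 add.commute)
  next
    case False
    have "conj x = of_real a + conj y" using conj_add[of "of_real a" y] conj_real[OF False] x by simp
    moreover have "of_real s = (of_real a + of_real a :: 'k)"
      by (simp add: a_def flip: of_real_add)
    ultimately have "of_real a + of_real a + (y + conj y) = (of_real a + of_real a :: 'k)"
      using s x by (simp add: algebra_simps)
    then have "y + conj y = 0" by (metis add_cancel_right_right)
    then show ?thesis by (simp add: eq_neg_iff_add_eq_0 add.commute)
  qed
  then have "y * y = - of_real ((norm y)\<^sup>2)" using mult_conj[of y] by (metis minus_minus mult_minus_right)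
  with x show ?thesis by (rule that)
qed

lemma rc_scalar_cases:
  "(\<forall>x::'k::rc_scalar. \<exists>a. x = of_real a) \<or>
   (\<exists>i::'k. i * i = -1 \<and> (\<forall>x. \<exists>a b. x = of_real a + of_real b * i))"
proof (cases "\<forall>x::'k. \<exists>a. x = of_real a")
  case False
  have unit: "(y / of_real (norm y)) * (y / of_real (norm y)) = -1"
    if "y * y = - of_real ((norm y)\<^sup>2)" "y \<noteq> 0" for y :: 'k
    using that by (simp add: power2_eq_square)
  obtain x :: 'k where x: "\<And>a. x \<noteq> of_real a" using False by blast
  obtain a y where y: "x = of_real a + y" "y * y = - of_real ((norm y)\<^sup>2)"
    by (rule rc_scalar_decompose)
  then have "y \<noteq> 0" using x[of a] by auto
  define i where "i = y / of_real (norm y)"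
  have i: "i * i = -1" unfolding i_def using unit y \<open>y \<noteq> 0\<close> by blast
  have "\<exists>a b. z = of_real a + of_real b * i" for z
  proof -
    obtain c w where w: "z = of_real c + w" "w * w = - of_real ((norm w)\<^sup>2)"
      by (rule rc_scalar_decompose)
    show ?thesis
    proof (cases "w = 0")
      case True
      then have "z = of_real c + of_real 0 * i" using w by simp
      then show ?thesis by blast
    next
      case False
      then have "(w / of_real (norm w)) * (w / of_real (norm w)) = i * i"
        using unit w i by metis
      then have "w / of_real (norm w) = i \<or> w / of_real (norm w) = - i"
        by (simp only: square_eq_iff)
      then have "w = of_real (norm w) * i \<or> w = of_real (- norm w) * i"
        using False by (auto simp: field_simps)
      then show ?thesis using w(1) by metis
    qed
  qed
  then show ?thesis using i by blast
qed blast

text \<open>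
  Norm and completeness come from the class \<^class>\<open>banach\<close>; the assumptions say that the norm is
  induced by the inner product, which is linear in its first argument.
\<close>

locale hilbert_space = vector_space smul
  for smul :: "'k::rc_scalar \<Rightarrow> 'a::banach \<Rightarrow> 'a" +
  fixes ip :: "'a \<Rightarrow> 'a \<Rightarrow> 'k"
  assumes scaleR_conv_smul: "r *\<^sub>R x = smul (of_real r) x"
    and ip_add_left: "ip (x + y) z = ip x z + ip y z"
    and ip_smul_left: "ip (smul c x) y = c * ip x y"
    and ip_commute: "ip x y = conj (ip y x)"
    and ip_self: "ip x x = of_real ((norm x)\<^sup>2)"

lemma hilbert_space_real:
  "hilbert_space (scaleR :: real \<Rightarrow> 'a::{real_inner,banach} \<Rightarrow> 'a) inner"
  by unfold_locales
    (simp_all add: algebra_simps conj_real_def inner_commute power2_norm_eq_inner)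

lemma hilbert_space_complex: "hilbert_space (*) (\<lambda>x y :: complex. x * cnj y)"
  by unfold_locales
    (simp_all add: algebra_simps conj_complex_def scaleR_conv_of_real complex_norm_square
      del: of_real_power)

definition is_frame :: "('a::real_normed_vector \<Rightarrow> 'a \<Rightarrow> 'k::real_normed_field) \<Rightarrow> (int \<Rightarrow> 'a) \<Rightarrow> bool"
  where "is_frame ip f \<longleftrightarrow>
    (\<exists>A>0. \<exists>B>0. \<forall>x.
      (\<lambda>k. (norm (ip x (f k)))\<^sup>2) summable_on UNIV \<and>
      A * (norm x)\<^sup>2 \<le> (\<Sum>\<^sub>\<infinity>k. (norm (ip x (f k)))\<^sup>2) \<and>
      (\<Sum>\<^sub>\<infinity>k. (norm (ip x (f k)))\<^sup>2) \<le> B * (norm x)\<^sup>2)"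

text \<open>
  An operator on a subspace \<open>S\<close> is represented by a total function whose values outside \<open>S\<close> are
  irrelevant.
\<close>

definition linear_op_on :: "('k::field \<Rightarrow> 'a::ab_group_add \<Rightarrow> 'a) \<Rightarrow> 'a set \<Rightarrow> ('a \<Rightarrow> 'a) \<Rightarrow> bool"
  where "linear_op_on smul S T \<longleftrightarrow>
    T ` S \<subseteq> S \<and>
    (\<forall>x\<in>S. \<forall>y\<in>S. T (x + y) = T x + T y) \<and>
    (\<forall>c. \<forall>x\<in>S. T (smul c x) = smul c (T x))"

definition bounded_op_on :: "'a::real_normed_vector set \<Rightarrow> ('a \<Rightarrow> 'a) \<Rightarrow> bool"
  where "bounded_op_on S T \<longleftrightarrow> (\<exists>C. \<forall>x\<in>S. norm (T x) \<le> C * norm x)"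

definition op_power_int :: "'a set \<Rightarrow> ('a \<Rightarrow> 'a) \<Rightarrow> int \<Rightarrow> 'a \<Rightarrow> 'a"
  where "op_power_int S T k =
    (if 0 \<le> k then T ^^ nat k else inv_into S T ^^ nat (- k))"

definition represented_by ::
    "('k::field \<Rightarrow> 'a::ab_group_add \<Rightarrow> 'a) \<Rightarrow> (int \<Rightarrow> 'a) \<Rightarrow> ('a \<Rightarrow> 'a) \<Rightarrow> bool"
  where "represented_by smul f T \<longleftrightarrow>
    linear_op_on smul (module.span smul (range f)) T \<and>
    bij_betw T (module.span smul (range f)) (module.span smul (range f)) \<and>
    (\<forall>k. f k = op_power_int (module.span smul (range f)) T k (f 0))"

end

theory Submission
  imports Defs
begin

text \<open>
  Put \<open>\<lambda> = max \<lambda>\<^sub>1 \<lambda>\<^sub>2\<close>. The hypothesis makes \<open>f\<^sub>k \<mapsto> g\<^sub>k\<close> extend to a linear bijection \<open>U\<close> between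
  the spans, bounded in both directions, and then \<open>V = U T U\<^sup>-\<^sup>1\<close>. The span of \<open>g\<close> is dense because
  \<open>(1 - t) I + t U\<close> is bounded below by \<open>(1 - \<lambda>) / 2\<close> uniformly in \<open>t \<in> [0, 1]\<close>, so that density of
  the range propagates from \<open>t = 0\<close> to \<open>t = 1\<close> in finitely many steps. For the lower frame bound, the
  step \<open>x \<mapsto> x - B\<^sup>-\<^sup>1 \<Sum>\<^sub>k \<langle>x, f\<^sub>k\<rangle> f\<^sub>k\<close> (over a large finite set of indices) contracts the norm; applied
  repeatedly in \<open>\<langle>U x, y\<rangle>\<close>, it bounds this number by a multiple of \<open>\<parallel>x\<parallel> (\<Sum>\<^sub>k |\<langle>y, g\<^sub>k\<rangle>|\<^sup>2)\<^sup>1\<^sup>/\<^sup>2\<close>, and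
  \<open>U x\<close> can be taken close to \<open>y\<close>.
\<close>

subsection \<open>Inner products\<close>

lemma norm_conj: "norm (conj x) = norm x" for x :: "'k::rc_scalar"
proof (cases "x = 0")
  case True
  have "conj (0::'k) = 0" using conj_add[of "0::'k" 0] by simp
  then show ?thesis using True by simp
next
  case False
  have "norm x * norm (conj x) = (norm x)\<^sup>2"
    using arg_cong[OF mult_conj[of x], of norm] by (simp add: norm_mult norm_power)
  then show ?thesis using False by (simp add: power2_eq_square)
qed

text \<open>Cancelling \<open>of_real r\<close> in the identity for \<open>x * conj x\<close> leaves
  this; at zero, where nothing can be cancelled, preservation of the norm decides.\<close>

lemma conj_of_real: "conj (of_real r :: 'k::rc_scalar) = of_real r"
proof (cases "r = 0")
  case True
  then show ?thesis using norm_conj[of "0::'k"] by simp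
next
  case False
  then show ?thesis using mult_conj[of "of_real r :: 'k"] by (simp add: power2_eq_square)
qed

context hilbert_space
begin

lemma ip_zero_left: "ip 0 x = 0"
  using ip_add_left[of 0 0 x] by simp

lemma ip_diff_left: "ip (x - y) z = ip x z - ip y z"
  using ip_add_left[of "x - y" y z] by simp

lemma ip_sum_left: "ip (\<Sum>k\<in>F. h k) z = (\<Sum>k\<in>F. ip (h k) z)"
  by (induction F rule: infinite_finite_induct) (simp_all add: ip_zero_left ip_add_left)

lemma norm_ip_commute: "norm (ip x y) = norm (ip y x)"
  by (metis ip_commute norm_conj)

text \<open>The class \<open>banach\<close> provides homogeneity for real scalars; for scalars in
  \<open>'k\<close> it is read off from the inner product of \<open>smul c x\<close> with
  itself.\<close>

lemma norm_smul: "norm (smul c x) = norm c * norm x"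
proof -
  have "ip (smul c x) (smul c x) = c * conj (c * ip x x)"
    by (metis ip_commute ip_smul_left)
  also have "\<dots> = of_real ((norm c * norm x)\<^sup>2)"
    by (simp only: conj_mult ip_self conj_of_real mult.assoc[symmetric] mult_conj
        of_real_mult[symmetric] power_mult_distrib)
  finally have "(norm (smul c x))\<^sup>2 = (norm c * norm x)\<^sup>2"
    by (simp only: ip_self of_real_eq_iff)
  then show ?thesis by (simp add: power2_eq_iff_nonneg)
qed

text \<open>A real inner product makes the two cross terms equal, so no real part has to be taken.
  The Cauchy-Schwarz inequality and the frame step both choose \<open>w\<close> so that
  \<open>ip w v\<close> is real.\<close>

lemma norm_diff_scaleR_sq:
  assumes "ip w v = of_real \<sigma>"
  shows "(norm (v - s *\<^sub>R w))\<^sup>2 = (norm v)\<^sup>2 - 2 * s * \<sigma> + s\<^sup>2 * (norm w)\<^sup>2"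
proof -
  have sw: "ip (s *\<^sub>R w) z = of_real s * ip w z" for z
    by (simp add: scaleR_conv_smul ip_smul_left)
  have vw: "ip v w = of_real \<sigma>"
    by (metis assms ip_commute conj_of_real)
  have v: "ip v (v - s *\<^sub>R w) = of_real ((norm v)\<^sup>2 - s * \<sigma>)"
    by (subst ip_commute) (simp add: ip_diff_left sw assms ip_self conj_of_real
        flip: of_real_mult of_real_diff of_real_power)
  have w: "ip w (v - s *\<^sub>R w) = of_real (\<sigma> - s * (norm w)\<^sup>2)"
    by (subst ip_commute) (simp add: ip_diff_left sw vw ip_self conj_of_real
        flip: of_real_mult of_real_diff of_real_power)
  have "of_real ((norm (v - s *\<^sub>R w))\<^sup>2)
      = (of_real (((norm v)\<^sup>2 - s * \<sigma>) - s * (\<sigma> - s * (norm w)\<^sup>2)) :: 'k)"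
    unfolding ip_self[symmetric] ip_diff_left[of v "s *\<^sub>R w" "v - s *\<^sub>R w"] sw v w
    by (simp only: of_real_diff of_real_mult)
  then show ?thesis
    unfolding of_real_eq_iff by (simp add: algebra_simps power2_eq_square)
qed

lemma ip_Cauchy_Schwarz: "norm (ip x y) \<le> norm x * norm y"
proof (cases "y = 0")
  case True
  then show ?thesis using norm_ip_commute[of x y] by (simp add: ip_zero_left)
next
  case False
  define p where "p = ip x y"
  \<comment> \<open>The factor \<open>p\<close> makes the inner product real, and the step
    \<open>1 / (norm y)\<^sup>2\<close> turns the multiple of \<open>smul p y\<close> into the
    orthogonal projection of \<open>x\<close> onto the line of \<open>y\<close>.\<close>
  have "ip (smul p y) x = of_real ((norm p)\<^sup>2)"
    by (metis ip_commute ip_smul_left mult_conj p_def)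
  from norm_diff_scaleR_sq[OF this, of "1 / (norm y)\<^sup>2"]
  have "0 \<le> (norm x)\<^sup>2 - 2 * (1 / (norm y)\<^sup>2) * (norm p)\<^sup>2
      + (1 / (norm y)\<^sup>2)\<^sup>2 * (norm (smul p y))\<^sup>2"
    by (metis zero_le_power2)
  then have "(norm p)\<^sup>2 \<le> (norm x * norm y)\<^sup>2"
    using False by (simp add: norm_smul power_mult_distrib field_simps power2_eq_square)
  then show ?thesis
    unfolding p_def by (rule power2_le_imp_le) simp
qed

end

lemma norm_sum_mult_le_L2_set:
  fixes a b :: "'i \<Rightarrow> 'k::real_normed_div_algebra"
  shows "norm (\<Sum>k\<in>F. a k * b k) \<le> sqrt (\<Sum>k\<in>F. (norm (a k))\<^sup>2) * sqrt (\<Sum>k\<in>F. (norm (b k))\<^sup>2)"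
proof -
  have "norm (\<Sum>k\<in>F. a k * b k) \<le> (\<Sum>k\<in>F. \<bar>norm (a k)\<bar> * \<bar>norm (b k)\<bar>)"
    by (rule sum_norm_le) (simp add: norm_mult)
  also have "\<dots> \<le> L2_set (\<lambda>k. norm (a k)) F * L2_set (\<lambda>k. norm (b k)) F"
    by (rule L2_set_mult_ineq)
  finally show ?thesis by (simp add: L2_set_def)
qed

subsection \<open>Dense additive subsets\<close>

text \<open>Applying \<open>step\<close> to the residual \<open>y - w\<close> and adding the
  correction to \<open>w\<close> multiplies the error by \<open>q\<close>; after \<open>n\<close>
  rounds it is at most \<open>q ^ n * norm y\<close>.\<close>

lemma dense_if_contracting:
  fixes W :: "'a::real_normed_vector set"
  assumes "0 \<in> W" and add: "\<And>u v. u \<in> W \<Longrightarrow> v \<in> W \<Longrightarrow> u + v \<in> W"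
    and step: "\<And>y. \<exists>w\<in>W. norm (y - w) \<le> q * norm y"
    and q: "0 \<le> q" "q < 1" and "0 < e"
  shows "\<exists>w\<in>W. norm (y - w) < e"
proof -
  have approx: "\<exists>w\<in>W. norm (y - w) \<le> q ^ n * norm y" for n
  proof (induction n)
    case 0
    then show ?case using \<open>0 \<in> W\<close> by (intro bexI[of _ 0]) auto
  next
    case (Suc n)
    then obtain w where w: "w \<in> W" "norm (y - w) \<le> q ^ n * norm y" by blast
    obtain w' where w': "w' \<in> W" "norm (y - w - w') \<le> q * norm (y - w)" using step by blast
    have "norm (y - (w + w')) \<le> q * norm (y - w)" using w'(2) by (simp add: diff_diff_eq)
    also have "\<dots> \<le> q * (q ^ n * norm y)" using w(2) q(1) by (rule mult_left_mono)
    finally show ?case using add[OF w(1) w'(1)] by (auto simp: mult.assoc)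
  qed
  have "(\<lambda>n. q ^ n * norm y) \<longlonglongrightarrow> 0 * norm y"
    using q by (intro tendsto_mult LIMSEQ_power_zero tendsto_const) auto
  then have "\<forall>\<^sub>F n in sequentially. q ^ n * norm y < e"
    using \<open>0 < e\<close> by (intro order_tendstoD) auto
  then obtain n where "q ^ n * norm y < e" by (auto simp: eventually_sequentially)
  then show ?thesis using approx[of n] by force
qed

text \<open>Method of continuity, with the additive relation \<open>G\<close> in the role of the
  graph of an operator. \<open>H t\<close> moves from the first projection to the second, and its
  lower bound is uniform in \<open>t\<close>.\<close>

lemma dense_snd_if_dense_fst:
  fixes G :: "('a::real_normed_vector \<times> 'a) set"
  assumes zero: "(0, 0) \<in> G"
    and add: "\<And>x z x' z'. (x, z) \<in> G \<Longrightarrow> (x', z') \<in> G \<Longrightarrow> (x + x', z + z') \<in> G"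
    and close: "\<And>x z. (x, z) \<in> G \<Longrightarrow> norm (x - z) \<le> l * (norm x + norm z)"
    and l: "0 \<le> l" "l < 1"
    and dense: "\<And>y e. 0 < e \<Longrightarrow> \<exists>(x, z)\<in>G. norm (y - x) < e"
    and "0 < e"
  shows "\<exists>(x, z)\<in>G. norm (y - z) < e"
proof -
  define H where "H t p = (1 - t) *\<^sub>R fst p + t *\<^sub>R snd p" for t and p :: "'a \<times> 'a"
  have bound: "norm (x - z) \<le> 2 / (1 - l) * norm (H t (x, z))"
    if G: "(x, z) \<in> G" and t: "0 \<le> t" "t \<le> 1" for x z t
  proof -
    let ?w = "H t (x, z)"
    \<comment> \<open>The weights \<open>t\<close> and \<open>1 - t\<close> add up to 1, so the two
      norms together cost a single copy of \<open>norm (x - z)\<close>, which \<open>close\<close>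
      absorbs because \<open>l < 1\<close>.\<close>
    have "x = ?w + t *\<^sub>R (x - z)" "z = ?w - (1 - t) *\<^sub>R (x - z)"
      by (simp_all add: H_def algebra_simps)
    then have "norm x \<le> norm ?w + t * norm (x - z)" "norm z \<le> norm ?w + (1 - t) * norm (x - z)"
      using t norm_triangle_ineq[of ?w "t *\<^sub>R (x - z)"]
        norm_triangle_ineq4[of ?w "(1 - t) *\<^sub>R (x - z)"] by simp_all
    then have "norm x + norm z \<le> 2 * norm ?w + norm (x - z)" by (simp add: algebra_simps)
    then have "(1 - l) * (norm x + norm z) \<le> 2 * norm ?w"
      using close[OF G] by (simp add: algebra_simps)
    then have "norm x + norm z \<le> 2 / (1 - l) * norm ?w"
      using l by (simp add: field_simps)
    moreover have "norm (x - z) \<le> norm x + norm z" by (rule norm_triangle_ineq4)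
    ultimately show ?thesis by linarith
  qed
  \<comment> \<open>The 10 is chosen so that moving \<open>t\<close> by \<open>1 / N\<close> costs
    at most \<open>norm v / 4\<close> below: the cost is \<open>1 / N\<close> times
    \<open>2 / (1 - l)\<close> from \<open>bound\<close> times
    \<open>5 / 4 * norm v\<close>.\<close>
  obtain N :: nat where N: "10 / (1 - l) < real N" using reals_Archimedean2 by blast
  have "0 < 10 / (1 - l)" using l by simp
  then have N0: "0 < real N" using N by linarith
  have small: "10 / real N \<le> 1 - l" using N l N0 by (simp add: field_simps)
  have main: "n \<le> N \<Longrightarrow> 0 < e \<Longrightarrow> \<exists>p\<in>G. norm (y - H (n / N) p) < e" for n e y
  proof (induction n arbitrary: e y)
    case 0
    then show ?case using dense[of e y] by (force simp: H_def)
  next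
    case (Suc n)
    let ?t = "real n / real N" and ?s = "real (Suc n) / real N"
    have t: "0 \<le> ?t" "?t \<le> 1" using Suc.prems N0 by auto
    have step: "\<exists>w\<in>H ?s ` G. norm (v - w) \<le> 1 / 2 * norm v" for v
    proof (cases "v = 0")
      case True
      then show ?thesis using zero by (intro bexI[of _ 0] image_eqI[of _ _ "(0, 0)"]) (auto simp: H_def)
    next
      case False
      \<comment> \<open>One quarter of \<open>norm v\<close> is spent on the approximation at
        \<open>?t\<close>, another on passing from \<open>?t\<close> to \<open>?s\<close>; together
        they give the contraction factor \<open>1 / 2\<close>. The tolerance must be positive, hence
        the separate case \<open>v = 0\<close>.\<close>
      then obtain x z where p: "(x, z) \<in> G" "norm (v - H ?t (x, z)) < norm v / 4"
        using Suc.IH[of "norm v / 4" v] Suc.prems by auto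
      have "H ?s (x, z) = H ?t (x, z) - (1 / N) *\<^sub>R (x - z)"
        by (simp add: H_def algebra_simps add_divide_distrib)
      then have "norm (v - H ?s (x, z)) = norm ((v - H ?t (x, z)) + (1 / N) *\<^sub>R (x - z))"
        by (simp only: diff_diff_eq2 diff_add_eq)
      also have "\<dots> \<le> norm (v - H ?t (x, z)) + 1 / N * norm (x - z)"
        using N0 norm_triangle_ineq[of "v - H ?t (x, z)" "(1 / N) *\<^sub>R (x - z)"] by simp
      also have "\<dots> \<le> norm v / 4 + 1 / N * (2 / (1 - l) * (5 / 4 * norm v))"
      proof (intro add_mono mult_left_mono)
        have "norm (H ?t (x, z)) \<le> 5 / 4 * norm v"
          using p(2) norm_triangle_ineq2[of "H ?t (x, z)" v] by (simp add: norm_minus_commute)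
        then have "2 / (1 - l) * norm (H ?t (x, z)) \<le> 2 / (1 - l) * (5 / 4 * norm v)"
          using l by (intro mult_left_mono) auto
        then show "norm (x - z) \<le> 2 / (1 - l) * (5 / 4 * norm v)"
          using bound[OF p(1) t] by linarith
      qed (use p(2) in auto)
      also have "\<dots> = norm v / 4 + (10 / N) / (1 - l) * (norm v / 4)"
        using N0 l by (simp add: divide_simps) (simp add: algebra_simps)
      also have "\<dots> \<le> norm v / 4 + 1 * (norm v / 4)"
        using small l by (intro add_left_mono mult_right_mono) (simp_all add: pos_divide_le_eq[of "1 - l"] del: divide_divide_eq_left)
      finally show ?thesis using p(1) by (intro bexI[of _ "H ?s (x, z)"]) auto
    qed
    have "\<exists>w\<in>H ?s ` G. norm (y - w) < e"
    proof (rule dense_if_contracting[OF _ _ step])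
      show "0 \<in> H ?s ` G" using zero by (intro image_eqI[of _ _ "(0, 0)"]) (auto simp: H_def)
      show "u + v \<in> H ?s ` G" if uv: "u \<in> H ?s ` G" "v \<in> H ?s ` G" for u v
      proof -
        from uv obtain p p' where pp: "p \<in> G" "p' \<in> G" "u = H ?s p" "v = H ?s p'" by blast
        have "u + v = H ?s (p + p')" by (simp add: pp H_def algebra_simps)
        moreover have "p + p' \<in> G" using add[of "fst p" "snd p" "fst p'" "snd p'"] pp
          by (simp add: plus_prod_def)
        ultimately show ?thesis by blast
      qed
    qed (use Suc.prems in auto)
    then show ?case by blast
  qed
  show ?thesis using main[of N e y] N0 \<open>0 < e\<close> by (auto simp: H_def)
qed

subsection \<open>Finite frame expansions\<close>

text \<open>The correspondence sending each \<open>f k\<close> to \<open>g k\<close>, extended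
  linearly. It is a relation because the \<open>f k\<close> may be linearly dependent, so that
  single-valuedness has to come from an estimate; it also treats both directions alike.\<close>

definition graph_pairs ::
    "('k::field \<Rightarrow> 'a::ab_group_add \<Rightarrow> 'a) \<Rightarrow> ('i \<Rightarrow> 'a) \<Rightarrow> ('i \<Rightarrow> 'a) \<Rightarrow> ('a \<times> 'a) set"
  where "graph_pairs smul f g =
    {((\<Sum>k\<in>F. smul (c k) (f k)), (\<Sum>k\<in>F. smul (c k) (g k))) | c F. finite F}"

lemma graph_pairs_swap: "(x, z) \<in> graph_pairs smul f g \<longleftrightarrow> (z, x) \<in> graph_pairs smul g f"
  unfolding graph_pairs_def by blast

lemma graph_pairsI:
  "finite F \<Longrightarrow> ((\<Sum>k\<in>F. smul (c k) (f k)), (\<Sum>k\<in>F. smul (c k) (g k))) \<in> graph_pairs smul f g"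
  unfolding graph_pairs_def by blast

context vector_space
begin

lemma graph_pairs_zero: "(0, 0) \<in> graph_pairs scale f g"
  using graph_pairsI[of "{}" scale _ f g] by simp

lemma graph_pairs_base: "(f k, g k) \<in> graph_pairs scale f g"
  using graph_pairsI[of "{k}" scale "\<lambda>_. 1" f g] by simp

lemma graph_pairs_add:
  assumes "(x, z) \<in> graph_pairs scale f g" "(x', z') \<in> graph_pairs scale f g"
  shows "(x + x', z + z') \<in> graph_pairs scale f g"
proof -
  obtain c F where 1: "finite F" "x = (\<Sum>k\<in>F. scale (c k) (f k))" "z = (\<Sum>k\<in>F. scale (c k) (g k))"
    using assms(1) unfolding graph_pairs_def by blast
  obtain d E where 2: "finite E" "x' = (\<Sum>k\<in>E. scale (d k) (f k))" "z' = (\<Sum>k\<in>E. scale (d k) (g k))"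
    using assms(2) unfolding graph_pairs_def by blast
  \<comment> \<open>Both families are extended by zero to \<open>F \<union> E\<close>; keeping
    \<open>h\<close> arbitrary lets the same coefficients serve for \<open>f\<close> and for
    \<open>g\<close>.\<close>
  have ext: "(\<Sum>k\<in>F. scale (c k) (h k)) + (\<Sum>k\<in>E. scale (d k) (h k)) =
      (\<Sum>k\<in>F \<union> E. scale ((if k \<in> F then c k else 0) + (if k \<in> E then d k else 0)) (h k))" for h
  proof -
    have "(\<Sum>k\<in>F. scale (c k) (h k)) = (\<Sum>k\<in>F \<union> E. scale (if k \<in> F then c k else 0) (h k))"
      "(\<Sum>k\<in>E. scale (d k) (h k)) = (\<Sum>k\<in>F \<union> E. scale (if k \<in> E then d k else 0) (h k))"
      using 1 2 by (auto intro!: sum.mono_neutral_cong_left)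
    then show ?thesis by (simp add: sum.distrib scale_left_distrib)
  qed
  show ?thesis unfolding 1 2 ext by (rule graph_pairsI) (use 1 2 in auto)
qed

lemma graph_pairs_scale:
  assumes "(x, z) \<in> graph_pairs scale f g"
  shows "(scale a x, scale a z) \<in> graph_pairs scale f g"
proof -
  obtain c F where "finite F" "x = (\<Sum>k\<in>F. scale (c k) (f k))" "z = (\<Sum>k\<in>F. scale (c k) (g k))"
    using assms unfolding graph_pairs_def by blast
  then show ?thesis
    using graph_pairsI[of F scale "\<lambda>k. a * c k" f g] by (simp add: scale_sum_right)
qed

lemma graph_pairs_diff:
  assumes "(x, z) \<in> graph_pairs scale f g" "(x', z') \<in> graph_pairs scale f g"
  shows "(x - x', z - z') \<in> graph_pairs scale f g"
  using graph_pairs_add[OF assms(1) graph_pairs_scale[OF assms(2), of "- 1"]] by simp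

lemma fst_graph_pairs: "fst ` graph_pairs scale f g = span (range f)"
proof
  show "fst ` graph_pairs scale f g \<subseteq> span (range f)"
    unfolding graph_pairs_def by (auto intro!: span_sum span_scale intro: span_base[OF rangeI])
  show "span (range f) \<subseteq> fst ` graph_pairs scale f g"
  proof (rule span_minimal)
    show "range f \<subseteq> fst ` graph_pairs scale f g"
      using graph_pairs_base by (force intro: image_eqI[of _ fst])
    show "subspace (fst ` graph_pairs scale f g)"
    proof (rule subspaceI)
      show "0 \<in> fst ` graph_pairs scale f g" using graph_pairs_zero by (rule rev_image_eqI) simp
      show "x + y \<in> fst ` graph_pairs scale f g"
        if "x \<in> fst ` graph_pairs scale f g" "y \<in> fst ` graph_pairs scale f g" for x y
        using that by (auto intro: rev_image_eqI[OF graph_pairs_add])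
      show "scale c x \<in> fst ` graph_pairs scale f g" if "x \<in> fst ` graph_pairs scale f g" for c x
        using that by (auto intro: rev_image_eqI[OF graph_pairs_scale])
    qed
  qed
qed

lemma in_span_iff_graph_pairs: "x \<in> span (range f) \<longleftrightarrow> (\<exists>z. (x, z) \<in> graph_pairs scale f g)"
  unfolding fst_graph_pairs[of f g, symmetric] by force

end

section \<open>The synthesis bound and one step of the frame algorithm\<close>

context hilbert_space
begin

text \<open>Synthesis is adjoint to analysis and so inherits its bound: expand \<open>ip v v\<close>
  for the sum \<open>v\<close>, apply Cauchy-Schwarz to the coefficients and cancel one factor
  \<open>norm v\<close>.\<close>

lemma norm_synthesis_le:
  assumes "finite F" "0 \<le> B"
    and "\<And>x. (\<Sum>k\<in>F. (norm (ip x (f k)))\<^sup>2) \<le> B * (norm x)\<^sup>2"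
  shows "norm (\<Sum>k\<in>F. smul (c k) (f k)) \<le> sqrt B * sqrt (\<Sum>k\<in>F. (norm (c k))\<^sup>2)"
proof -
  define v where "v = (\<Sum>k\<in>F. smul (c k) (f k))"
  have "(norm v)\<^sup>2 = norm (ip v v)" by (simp add: ip_self norm_power)
  also have "ip v v = (\<Sum>k\<in>F. c k * ip (f k) v)"
    by (subst (1) v_def) (simp add: ip_sum_left ip_smul_left)
  also have "norm \<dots> \<le> sqrt (\<Sum>k\<in>F. (norm (c k))\<^sup>2) * sqrt (\<Sum>k\<in>F. (norm (ip (f k) v))\<^sup>2)"
    by (rule norm_sum_mult_le_L2_set)
  also have "\<dots> \<le> sqrt (\<Sum>k\<in>F. (norm (c k))\<^sup>2) * (sqrt B * norm v)"
  proof (rule mult_left_mono)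
    have "(\<Sum>k\<in>F. (norm (ip (f k) v))\<^sup>2) \<le> B * (norm v)\<^sup>2"
      using assms(3)[of v] by (simp add: norm_ip_commute[of _ v])
    then have "sqrt (\<Sum>k\<in>F. (norm (ip (f k) v))\<^sup>2) \<le> sqrt (B * (norm v)\<^sup>2)"
      by (rule real_sqrt_le_mono)
    then show "sqrt (\<Sum>k\<in>F. (norm (ip (f k) v))\<^sup>2) \<le> sqrt B * norm v"
      by (simp add: real_sqrt_mult)
  qed (simp add: sum_nonneg)
  finally have "norm v * norm v \<le> (sqrt B * sqrt (\<Sum>k\<in>F. (norm (c k))\<^sup>2)) * norm v"
    by (simp add: power2_eq_square mult_ac)
  then show ?thesis
    using assms(2) unfolding v_def[symmetric] by (cases "v = 0") (auto simp: sum_nonneg)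
qed

text \<open>One step of the frame algorithm with a partial frame operator. The finite set
  \<open>F\<close> depends on \<open>x\<close> and captures half of the lower bound, hence
  \<open>A / (2 * B)\<close>; the coefficient bound serves to sum up repeated steps.\<close>

lemma finite_frame_step:
  assumes AB: "0 < A" "A \<le> B"
    and sm: "\<And>x. (\<lambda>k. (norm (ip x (f k)))\<^sup>2) summable_on UNIV"
    and lower: "\<And>x. A * (norm x)\<^sup>2 \<le> (\<Sum>\<^sub>\<infinity>k. (norm (ip x (f k)))\<^sup>2)"
    and upper: "\<And>x. (\<Sum>\<^sub>\<infinity>k. (norm (ip x (f k)))\<^sup>2) \<le> B * (norm x)\<^sup>2"
  obtains F c where "finite F"
    "norm (x - (\<Sum>k\<in>F. smul (c k) (f k))) \<le> sqrt (1 - A / (2 * B)) * norm x"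
    "sqrt (\<Sum>k\<in>F. (norm (c k))\<^sup>2) \<le> norm x / sqrt B"
proof -
  have fin: "(\<Sum>k\<in>F. (norm (ip y (f k)))\<^sup>2) \<le> B * (norm y)\<^sup>2" if "finite F" for F y
    using finite_sum_le_infsum[OF sm[of y] that] upper[of y] by force
  \<comment> \<open>If every finite sum stayed below this value, so would the infinite one, against
    \<open>lower\<close> unless \<open>x = 0\<close>; in that case the empty set does.\<close>
  have "\<exists>F. finite F \<and> A / 2 * (norm x)\<^sup>2 \<le> (\<Sum>k\<in>F. (norm (ip x (f k)))\<^sup>2)"
  proof (rule ccontr)
    assume less: "\<not> ?thesis"
    then have "(\<Sum>\<^sub>\<infinity>k. (norm (ip x (f k)))\<^sup>2) \<le> A / 2 * (norm x)\<^sup>2"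
      by (intro infsum_le_finite_sums sm) force
    then have "A / 2 * (norm x)\<^sup>2 \<le> 0" using lower[of x] by simp
    then have "x = 0" using AB by (simp add: mult_le_0_iff)
    then show False using less by (auto dest: spec[of _ "{}"])
  qed
  then obtain F where F: "finite F" "A / 2 * (norm x)\<^sup>2 \<le> (\<Sum>k\<in>F. (norm (ip x (f k)))\<^sup>2)"
    by blast
  define \<sigma> where "\<sigma> = (\<Sum>k\<in>F. (norm (ip x (f k)))\<^sup>2)"
  define w where "w = (\<Sum>k\<in>F. smul (ip x (f k)) (f k))"
  \<comment> \<open>Since the squared norm of \<open>w\<close> is at most
    \<open>B * \<sigma>\<close>, a step \<open>s\<close> changes that of \<open>x\<close> by at most
    \<open>- 2 * s * \<sigma> + s\<^sup>2 * B * \<sigma>\<close>; this is smallest at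
    \<open>s = 1 / B\<close>.\<close>
  define c where "c k = of_real (1 / B) * ip x (f k)" for k
  have B: "0 < B" using AB by simp
  have "0 \<le> \<sigma>" by (simp add: \<sigma>_def sum_nonneg)
  have wx: "ip w x = of_real \<sigma>"
  proof -
    have "ip (f k) x = conj (ip x (f k))" for k by (rule ip_commute)
    then show ?thesis
      by (simp add: w_def \<sigma>_def ip_sum_left ip_smul_left mult_conj)
  qed
  have "norm w \<le> sqrt B * sqrt \<sigma>"
    unfolding w_def \<sigma>_def by (rule norm_synthesis_le) (use F B fin in auto)
  then have "(norm w)\<^sup>2 \<le> (sqrt B * sqrt \<sigma>)\<^sup>2" by (rule power_mono) simp
  then have w: "(norm w)\<^sup>2 \<le> B * \<sigma>" using B \<open>0 \<le> \<sigma>\<close> by (simp add: power_mult_distrib)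
  have cw: "(\<Sum>k\<in>F. smul (c k) (f k)) = (1 / B) *\<^sub>R w"
    by (simp only: c_def w_def scaleR_conv_smul scale_sum_right scale_scale)
  have "(norm (x - (1 / B) *\<^sub>R w))\<^sup>2 = (norm x)\<^sup>2 - 2 * (1 / B) * \<sigma> + (1 / B)\<^sup>2 * (norm w)\<^sup>2"
    by (rule norm_diff_scaleR_sq[OF wx])
  also have "\<dots> \<le> (norm x)\<^sup>2 - 2 * (1 / B) * \<sigma> + (1 / B)\<^sup>2 * (B * \<sigma>)"
    using w by (intro add_left_mono mult_left_mono) auto
  also have "\<dots> = (norm x)\<^sup>2 - \<sigma> / B" using B by (simp add: power2_eq_square)
  also have "\<dots> \<le> (norm x)\<^sup>2 - A / 2 * (norm x)\<^sup>2 / B"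
    using F(2) B unfolding \<sigma>_def[symmetric] by (intro diff_left_mono divide_right_mono) auto
  also have "\<dots> = (1 - A / (2 * B)) * (norm x)\<^sup>2" by (simp add: algebra_simps)
  finally have "norm (x - (1 / B) *\<^sub>R w) \<le> sqrt ((1 - A / (2 * B)) * (norm x)\<^sup>2)"
    by (rule real_le_rsqrt)
  then have 1: "norm (x - (\<Sum>k\<in>F. smul (c k) (f k))) \<le> sqrt (1 - A / (2 * B)) * norm x"
    by (simp add: cw real_sqrt_mult)
  have "(\<Sum>k\<in>F. (norm (c k))\<^sup>2) = (\<Sum>k\<in>F. (1 / B)\<^sup>2 * (norm (ip x (f k)))\<^sup>2)"
    using B by (intro sum.cong refl) (simp add: c_def norm_mult norm_divide power_mult_distrib power_divide)
  also have "\<dots> = (1 / B)\<^sup>2 * \<sigma>" by (simp add: \<sigma>_def sum_distrib_left)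
  also have "\<dots> \<le> (1 / B)\<^sup>2 * (B * (norm x)\<^sup>2)"
    using fin[OF F(1), of x] unfolding \<sigma>_def by (rule mult_left_mono) simp
  also have "\<dots> = (norm x)\<^sup>2 / B" using B by (simp add: power2_eq_square)
  finally have "sqrt (\<Sum>k\<in>F. (norm (c k))\<^sup>2) \<le> sqrt ((norm x)\<^sup>2 / B)"
    by (rule real_sqrt_le_mono)
  then have 2: "sqrt (\<Sum>k\<in>F. (norm (c k))\<^sup>2) \<le> norm x / sqrt B"
    by (simp add: real_sqrt_divide)
  show ?thesis using F(1) 1 2 by (rule that)
qed

subsection \<open>Perturbed frames\<close>

text \<open>The perturbation enters through the graph alone: \<open>close\<close> yields density of
  the span of \<open>g\<close>, and the two bounds by \<open>K\<close> carry estimates from one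
  sequence to the other.\<close>

lemma is_frame_perturbed:
  assumes "is_frame ip f" and l: "0 \<le> l" "l < 1"
    and close: "\<And>x z. (x, z) \<in> graph_pairs smul f g \<Longrightarrow> norm (x - z) \<le> l * (norm x + norm z)"
    and K: "0 < K" "\<And>x z. (x, z) \<in> graph_pairs smul f g \<Longrightarrow> norm z \<le> K * norm x"
      "\<And>x z. (x, z) \<in> graph_pairs smul f g \<Longrightarrow> norm x \<le> K * norm z"
  shows "is_frame ip g"
proof -
  let ?G = "graph_pairs smul f g"
  obtain A B0 where A: "0 < A" and "0 < B0"
    and sm: "\<And>x. (\<lambda>k. (norm (ip x (f k)))\<^sup>2) summable_on UNIV"
    and lower: "\<And>x. A * (norm x)\<^sup>2 \<le> (\<Sum>\<^sub>\<infinity>k. (norm (ip x (f k)))\<^sup>2)"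
    and upper0: "\<And>x. (\<Sum>\<^sub>\<infinity>k. (norm (ip x (f k)))\<^sup>2) \<le> B0 * (norm x)\<^sup>2"
    using assms(1) unfolding is_frame_def by blast
  \<comment> \<open>In the zero space a frame may have \<open>A > B0\<close>.\<close>
  define B where "B = max A B0"
  have B: "0 < B" "A \<le> B" using A by (auto simp: B_def)
  have upper: "(\<Sum>\<^sub>\<infinity>k. (norm (ip x (f k)))\<^sup>2) \<le> B * (norm x)\<^sup>2" for x
  proof -
    have "B0 * (norm x)\<^sup>2 \<le> B * (norm x)\<^sup>2" by (rule mult_right_mono) (auto simp: B_def)
    then show ?thesis using upper0[of x] by linarith
  qed
  define q where "q = sqrt (1 - A / (2 * B))"
  have q: "0 \<le> q" "q < 1" using A B by (auto simp: q_def)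
  note step = finite_frame_step[OF A B(2) sm lower upper, folded q_def]

  \<comment> \<open>Density of the two spans\<close>
  have dense_f: "\<exists>(x, z)\<in>?G. norm (y - x) < e" if "0 < e" for y e
  proof -
    have "\<exists>w\<in>fst ` ?G. norm (y - w) < e"
    proof (rule dense_if_contracting[OF _ _ _ q that])
      show "0 \<in> fst ` ?G" "\<And>u v. u \<in> fst ` ?G \<Longrightarrow> v \<in> fst ` ?G \<Longrightarrow> u + v \<in> fst ` ?G"
        unfolding fst_graph_pairs by (auto intro: span_zero span_add)
      show "\<exists>w\<in>fst ` ?G. norm (x - w) \<le> q * norm x" for x
        by (rule step[of x]) (use graph_pairsI[of _ smul _ f g] in force)
    qed
    then show ?thesis by force
  qed
  have dense_g: "\<exists>(x, z)\<in>?G. norm (y - z) < e" if "0 < e" for y e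
    by (rule dense_snd_if_dense_fst[OF graph_pairs_zero graph_pairs_add close l dense_f that])

  \<comment> \<open>Upper frame bound for \<open>g\<close>\<close>
  have fin_f: "(\<Sum>k\<in>F. (norm (ip y (f k)))\<^sup>2) \<le> B * (norm y)\<^sup>2" if "finite F" for F y
    using finite_sum_le_infsum[OF sm[of y] that] upper[of y] by force
  have fin_g: "(\<Sum>k\<in>F. (norm (ip y (g k)))\<^sup>2) \<le> (K\<^sup>2 * B) * (norm y)\<^sup>2" if F: "finite F" for F y
  proof -
    define s where "s = sqrt (\<Sum>k\<in>F. (norm (ip y (g k)))\<^sup>2)"
    \<comment> \<open>With these coefficients \<open>ip z y\<close> equals \<open>s\<^sup>2\<close>,
      while \<open>norm z\<close> is at most \<open>K\<close> times a synthesis sum of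
      \<open>f\<close>, hence linear in \<open>s\<close>; one factor \<open>s\<close> then
      cancels.\<close>
    define z where "z = (\<Sum>k\<in>F. smul (ip y (g k)) (g k))"
    have s: "0 \<le> s" "s\<^sup>2 = (\<Sum>k\<in>F. (norm (ip y (g k)))\<^sup>2)" by (simp_all add: s_def sum_nonneg)
    have "ip z y = of_real (s\<^sup>2)"
    proof -
      have "ip (g k) y = conj (ip y (g k))" for k by (rule ip_commute)
      then show ?thesis unfolding s(2) by (simp add: z_def ip_sum_left ip_smul_left mult_conj)
    qed
    then have "s\<^sup>2 = norm (ip z y)" by (simp add: norm_power)
    also have "\<dots> \<le> norm z * norm y" by (rule ip_Cauchy_Schwarz)
    also have "\<dots> \<le> (K * (sqrt B * s)) * norm y"
    proof (rule mult_right_mono)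
      have "norm z \<le> K * norm (\<Sum>k\<in>F. smul (ip y (g k)) (f k))"
        unfolding z_def by (rule K(2)) (rule graph_pairsI[OF F])
      also have "\<dots> \<le> K * (sqrt B * s)"
        unfolding s_def using K(1) B(1) norm_synthesis_le[OF F _ fin_f[OF F]] by (intro mult_left_mono) auto
      finally show "norm z \<le> K * (sqrt B * s)" .
    qed simp
    finally have "s * s \<le> (K * sqrt B * norm y) * s" by (simp add: power2_eq_square mult_ac)
    then have "s \<le> K * sqrt B * norm y"
      using s(1) K(1) B by (cases "s = 0") auto
    then have "s\<^sup>2 \<le> (K * sqrt B * norm y)\<^sup>2" using s(1) by (rule power_mono)
    then show ?thesis using B unfolding s(2) by (simp add: power_mult_distrib)
  qed
  have sm_g: "(\<lambda>k. (norm (ip y (g k)))\<^sup>2) summable_on UNIV" for y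
    by (rule nonneg_bdd_above_summable_on) (auto intro!: bdd_aboveI2 fin_g)
  have upper_g: "(\<Sum>\<^sub>\<infinity>k. (norm (ip y (g k)))\<^sup>2) \<le> (K\<^sup>2 * B) * (norm y)\<^sup>2" for y
    by (intro infsum_le_finite_sums sm_g fin_g)

  \<comment> \<open>Lower frame bound for \<open>g\<close>\<close>
  have lower_g: "(B * (1 - q)\<^sup>2 / K\<^sup>2) * (norm y)\<^sup>2 \<le> (\<Sum>\<^sub>\<infinity>k. (norm (ip y (g k)))\<^sup>2)" for y
  proof -
    define \<tau> where "\<tau> = sqrt (\<Sum>\<^sub>\<infinity>k. (norm (ip y (g k)))\<^sup>2)"
    have \<tau>: "0 \<le> \<tau>" "\<tau>\<^sup>2 = (\<Sum>\<^sub>\<infinity>k. (norm (ip y (g k)))\<^sup>2)" by (simp_all add: \<tau>_def infsum_nonneg)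
    \<comment> \<open>\<open>D\<close> is the sum of the geometric series with first term
      \<open>\<tau> / sqrt B\<close> and ratio \<open>q\<close>, that is, the fixed point stated in
      \<open>Dq\<close>.\<close>
    define D where "D = \<tau> / sqrt B / (1 - q)"
    have D: "0 \<le> D" using \<tau> q B by (simp add: D_def)
    have Dq: "\<tau> / sqrt B + q * D = D"
    proof -
      have "\<tau> / sqrt B = (1 - q) * D" using q by (simp add: D_def)
      then show ?thesis by (simp add: algebra_simps)
    qed
    \<comment> \<open>Each of \<open>n\<close> frame steps on \<open>x\<close> splits off a finite
      sum controlled by \<open>\<tau>\<close>. What is left is again a pair in \<open>?G\<close>,
      with first component smaller by \<open>q\<close>, so the crude bound by
      \<open>K * norm y\<close> enters only with the factor \<open>q ^ n\<close>.\<close>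
    have bound: "norm (ip z y) \<le> (D + q ^ n * (K * norm y)) * norm x" if "(x, z) \<in> ?G" for n x z
      using that
    proof (induction n arbitrary: x z)
      case 0
      have "norm (ip z y) \<le> norm z * norm y" by (rule ip_Cauchy_Schwarz)
      also have "\<dots> \<le> (K * norm x) * norm y" using K(2)[OF 0] by (rule mult_right_mono) simp
      also have "\<dots> \<le> (D + K * norm y) * norm x" using D by (simp add: algebra_simps)
      finally show ?case by simp
    next
      case (Suc n)
      let ?M = "D + q ^ n * (K * norm y)"
      obtain F c where F: "finite F"
        and x: "norm (x - (\<Sum>k\<in>F. smul (c k) (f k))) \<le> q * norm x"
        and c: "sqrt (\<Sum>k\<in>F. (norm (c k))\<^sup>2) \<le> norm x / sqrt B"
        by (rule step)
      define z1 where "z1 = (\<Sum>k\<in>F. smul (c k) (g k))"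
      have "norm (ip z y) \<le> norm (ip z1 y) + norm (ip (z - z1) y)"
        using norm_triangle_ineq[of "ip z1 y" "ip (z - z1) y"] by (simp add: ip_diff_left)
      also have "\<dots> \<le> norm x / sqrt B * \<tau> + ?M * (q * norm x)"
      proof (rule add_mono)
        have "norm (ip z1 y) \<le> sqrt (\<Sum>k\<in>F. (norm (c k))\<^sup>2) * sqrt (\<Sum>k\<in>F. (norm (ip (g k) y))\<^sup>2)"
          unfolding z1_def ip_sum_left ip_smul_left by (rule norm_sum_mult_le_L2_set)
        also have "\<dots> \<le> norm x / sqrt B * \<tau>"
        proof (rule mult_mono[OF c])
          show "sqrt (\<Sum>k\<in>F. (norm (ip (g k) y))\<^sup>2) \<le> \<tau>"
            unfolding \<tau>_def norm_ip_commute[of _ y]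
            by (intro real_sqrt_le_mono finite_sum_le_infsum sm_g F) auto
        qed (use B in \<open>auto simp: sum_nonneg\<close>)
        finally show "norm (ip z1 y) \<le> norm x / sqrt B * \<tau>" .
        have "norm (ip (z - z1) y) \<le> ?M * norm (x - (\<Sum>k\<in>F. smul (c k) (f k)))"
          unfolding z1_def by (intro Suc.IH graph_pairs_diff Suc.prems graph_pairsI F)
        also have "\<dots> \<le> ?M * (q * norm x)"
          using x D K(1) q by (intro mult_left_mono) auto
        finally show "norm (ip (z - z1) y) \<le> ?M * (q * norm x)" .
      qed
      also have "\<dots> = ((\<tau> / sqrt B + q * D) + q ^ Suc n * (K * norm y)) * norm x"
        by (simp add: algebra_simps)
      finally show ?case unfolding Dq .
    qed
    \<comment> \<open>Letting \<open>n\<close> tend to infinity removes the crude term. The bound is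
      then expressed by \<open>norm z\<close>, because it is \<open>z\<close> that will approximate
      \<open>y\<close>.\<close>
    have zy: "norm (ip z y) \<le> D * K * norm z" if G: "(x, z) \<in> ?G" for x z
    proof -
      have "(\<lambda>n. (D + q ^ n * (K * norm y)) * norm x) \<longlonglongrightarrow> (D + 0 * (K * norm y)) * norm x"
        using q by (intro tendsto_intros LIMSEQ_power_zero) auto
      then have "norm (ip z y) \<le> D * norm x"
        using bound[OF G] LIMSEQ_le_const by fastforce
      also have "\<dots> \<le> D * (K * norm z)" using K(3)[OF G] D by (rule mult_left_mono)
      finally show ?thesis by (simp add: mult.assoc)
    qed
    have "(norm y)\<^sup>2 \<le> D * K * norm y"
    proof (rule field_le_epsilon)
      fix e :: real assume "0 < e"
      \<comment> \<open>Replacing \<open>y\<close> by \<open>z\<close> costs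
        \<open>d * (D * K)\<close> and \<open>d * norm y\<close>, together at most \<open>e\<close>;
        the added 1 keeps the denominator positive.\<close>
      define d where "d = e / (D * K + norm y + 1)"
      have pos: "0 < D * K + norm y + 1" using D K(1) by (simp add: add_nonneg_pos)
      then have "0 < d" using \<open>0 < e\<close> by (simp add: d_def)
      then obtain x z where G: "(x, z) \<in> ?G" "norm (y - z) < d" using dense_g[of d y] by auto
      have "(norm y)\<^sup>2 = norm (ip y y)" by (simp add: ip_self norm_power)
      also have "\<dots> \<le> norm (ip z y) + norm (ip (y - z) y)"
        using norm_triangle_ineq[of "ip z y" "ip (y - z) y"] by (simp add: ip_diff_left)
      also have "\<dots> \<le> D * K * (norm y + d) + d * norm y"
      proof (rule add_mono)
        have "norm z \<le> norm y + d"
          using G(2) norm_triangle_ineq2[of z y] by (simp add: norm_minus_commute)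
        then have "D * K * norm z \<le> D * K * (norm y + d)" using D K(1) by (intro mult_left_mono) auto
        then show "norm (ip z y) \<le> D * K * (norm y + d)" using zy[OF G(1)] by linarith
        have "norm (ip (y - z) y) \<le> norm (y - z) * norm y" by (rule ip_Cauchy_Schwarz)
        also have "\<dots> \<le> d * norm y" using G(2) by (intro mult_right_mono) auto
        finally show "norm (ip (y - z) y) \<le> d * norm y" .
      qed
      also have "\<dots> \<le> D * K * norm y + d * (D * K + norm y + 1)"
        using \<open>0 < d\<close> by (simp add: algebra_simps)
      also have "d * (D * K + norm y + 1) = e" using pos by (simp add: d_def)
      finally show "(norm y)\<^sup>2 \<le> D * K * norm y + e" .
    qed
    then have "norm y \<le> D * K"
      using D K(1) by (cases "y = 0") (auto simp: power2_eq_square)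
    then have "(norm y)\<^sup>2 \<le> (D * K)\<^sup>2" by (rule power_mono) simp
    also have "\<dots> = \<tau>\<^sup>2 * K\<^sup>2 / (B * (1 - q)\<^sup>2)"
      using B by (simp add: D_def power_mult_distrib power_divide)
    finally show ?thesis
      using B q K(1) unfolding \<tau>(2)[symmetric] by (simp add: field_simps)
  qed
  have "0 < B * (1 - q)\<^sup>2 / K\<^sup>2" "0 < K\<^sup>2 * B" using B q K(1) by simp_all
  then show ?thesis using sm_g lower_g upper_g unfolding is_frame_def by blast
qed

end

subsection \<open>Sequences generated by an operator\<close>

text \<open>Trades integer powers for a one-step recursion, the form that passes easily from
  \<open>T\<close> to \<open>V\<close>. For negative indices, \<open>inv_into S T\<close> undoes
  \<open>T\<close> because the orbit stays in \<open>S\<close>.\<close>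

lemma op_power_int_orbit_iff:
  assumes bij: "bij_betw T S S" and S: "\<And>k. f k \<in> S"
  shows "(\<forall>k. f k = op_power_int S T k (f 0)) \<longleftrightarrow> (\<forall>k. T (f k) = f (k + 1))"
proof
  assume orbit: "\<forall>k. f k = op_power_int S T k (f 0)"
  show "\<forall>k. T (f k) = f (k + 1)"
  proof
    fix k :: int
    show "T (f k) = f (k + 1)"
    proof (cases "0 \<le> k")
      case True
      then have "nat (k + 1) = Suc (nat k)" by simp
      then show ?thesis
        using True orbit[rule_format, of k] orbit[rule_format, of "k + 1"]
        by (simp add: op_power_int_def)
    next
      case False
      then have n: "nat (- k) = Suc (nat (- (k + 1)))" by simp
      \<comment> \<open>At \<open>k = - 1\<close> the index \<open>k + 1\<close> falls into the
        branch of nonnegative powers; the zeroth power is the identity in both branches.\<close>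
      have "f (k + 1) = (inv_into S T ^^ nat (- (k + 1))) (f 0)"
        using False orbit[rule_format, of "k + 1"] by (cases "k = - 1") (simp_all add: op_power_int_def)
      then have "f k = inv_into S T (f (k + 1))"
        using False orbit[rule_format, of k] n by (simp add: op_power_int_def)
      then show ?thesis using bij_betw_inv_into_right[OF bij S] by simp
    qed
  qed
next
  assume shift: "\<forall>k. T (f k) = f (k + 1)"
  have pos: "f (int n) = (T ^^ n) (f 0)" for n
    by (induction n) (simp_all add: shift[rule_format, symmetric] add.commute[of 1])
  have neg: "f (- int n) = (inv_into S T ^^ n) (f 0)" for n
  proof (induction n)
    case (Suc n)
    have "T (f (- int (Suc n))) = f (- int n)" using shift by simp
    then have "f (- int (Suc n)) = inv_into S T (f (- int n))"
      using bij_betw_inv_into_left[OF bij S] by metis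
    then show ?case using Suc by simp
  qed simp
  show "\<forall>k. f k = op_power_int S T k (f 0)"
  proof
    fix k :: int
    show "f k = op_power_int S T k (f 0)"
      using pos[of "nat k"] neg[of "nat (- k)"] by (cases "0 \<le> k") (simp_all add: op_power_int_def)
  qed
qed

context vector_space
begin

text \<open>By \<open>inj\<close> the relation is the graph of a linear bijection U between the
  spans, and V is the conjugate of T by U. The second conclusion says that V U = U T, from which
  boundedness will be transferred.\<close>

lemma represented_by_transfer:
  assumes rep: "represented_by scale f T"
    and inj: "\<And>x z. (x, z) \<in> graph_pairs scale f g \<Longrightarrow> x = 0 \<longleftrightarrow> z = 0"
  obtains V where "represented_by scale g V"
    "\<And>x z. (x, z) \<in> graph_pairs scale f g \<Longrightarrow> (T x, V z) \<in> graph_pairs scale f g"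
proof -
  let ?G = "graph_pairs scale f g"
  let ?S = "span (range f)" and ?R = "span (range g)"
  have lin: "linear_op_on scale ?S T" and bij: "bij_betw T ?S ?S"
    and orbit: "\<forall>k. f k = op_power_int ?S T k (f 0)"
    using rep unfolding represented_by_def by blast+
  have shift: "T (f k) = f (k + 1)" for k
    using op_power_int_orbit_iff[OF bij span_base[OF rangeI], THEN iffD1, OF orbit] by blast
  have uniq: "x = x' \<longleftrightarrow> z = z'" if "(x, z) \<in> ?G" "(x', z') \<in> ?G" for x z x' z'
    using inj[OF graph_pairs_diff[OF that]] by auto
  have S: "x \<in> ?S \<longleftrightarrow> (\<exists>z. (x, z) \<in> ?G)" for x by (rule in_span_iff_graph_pairs)
  have R: "z \<in> ?R \<longleftrightarrow> (\<exists>x. (x, z) \<in> ?G)" for z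
    using in_span_iff_graph_pairs[of z g f] by (simp add: graph_pairs_swap[of _ _ _ f])
  \<comment> \<open>On \<open>?R\<close> the chosen \<open>v\<close> exists and is unique by
    \<open>uniq\<close>; elsewhere the value is arbitrary.\<close>
  define V where "V z = (SOME v. \<exists>x. (x, z) \<in> ?G \<and> (T x, v) \<in> ?G)" for z
  have TS: "T x \<in> ?S" if "x \<in> ?S" for x using bij that by (rule bij_betw_apply)
  have V: "(T x, V z) \<in> ?G" if xz: "(x, z) \<in> ?G" for x z
  proof -
    have "\<exists>v x. (x, z) \<in> ?G \<and> (T x, v) \<in> ?G" using xz TS[of x] S by blast
    then have "\<exists>x. (x, z) \<in> ?G \<and> (T x, V z) \<in> ?G" unfolding V_def by (rule someI_ex)
    then show ?thesis using uniq xz by blast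
  qed
  have Veq: "V z = v" if "(x, z) \<in> ?G" "(T x, v) \<in> ?G" for x z v
    using V[OF that(1)] that(2) uniq by blast
  have linV: "linear_op_on scale ?R V"
    unfolding linear_op_on_def
  proof (intro conjI ballI allI subsetI)
    show "v \<in> ?R" if "v \<in> V ` ?R" for v using that V R by blast
    show "V (z + z') = V z + V z'" if "z \<in> ?R" "z' \<in> ?R" for z z'
    proof -
      obtain x x' where x: "(x, z) \<in> ?G" "(x', z') \<in> ?G" using \<open>z \<in> ?R\<close> \<open>z' \<in> ?R\<close> R by blast
      have "T (x + x') = T x + T x'" using lin x S unfolding linear_op_on_def by blast
      then show ?thesis
        using Veq[OF graph_pairs_add[OF x]] graph_pairs_add[OF x[THEN V]] by simp
    qed
    show "V (scale c z) = scale c (V z)" if "z \<in> ?R" for c z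
    proof -
      obtain x where x: "(x, z) \<in> ?G" using \<open>z \<in> ?R\<close> R by blast
      have "T (scale c x) = scale c (T x)" using lin x S unfolding linear_op_on_def by blast
      then show ?thesis
        using Veq[OF graph_pairs_scale[OF x]] graph_pairs_scale[OF V[OF x]] by simp
    qed
  qed
  have bijV: "bij_betw V ?R ?R"
  proof (rule bij_betw_imageI)
    show "inj_on V ?R"
    proof (rule inj_onI)
      fix z z' assume "z \<in> ?R" "z' \<in> ?R" and eq: "V z = V z'"
      then obtain x x' where x: "(x, z) \<in> ?G" "(x', z') \<in> ?G" using R by blast
      have "T x = T x'" using x[THEN V] eq uniq by blast
      moreover have "x \<in> ?S" "x' \<in> ?S" using x S by blast+
      ultimately have "x = x'" using bij unfolding bij_betw_def by (auto dest: inj_onD)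
      then show "z = z'" using x uniq by blast
    qed
    show "V ` ?R = ?R"
    proof
      show "V ` ?R \<subseteq> ?R" using V R by blast
      show "?R \<subseteq> V ` ?R"
      proof
        fix v assume "v \<in> ?R"
        then obtain w where w: "(w, v) \<in> ?G" using R by blast
        then have "w \<in> T ` ?S" using S bij unfolding bij_betw_def by blast
        then obtain x where x: "x \<in> ?S" "w = T x" by blast
        then obtain z where "(x, z) \<in> ?G" using S by blast
        then show "v \<in> V ` ?R" using Veq w x R by blast
      qed
    qed
  qed
  have "V (g k) = g (k + 1)" for k
    by (rule Veq[OF graph_pairs_base]) (simp add: shift graph_pairs_base)
  then have "\<forall>k. g k = op_power_int ?R V k (g 0)"
    by (intro op_power_int_orbit_iff[OF bijV span_base[OF rangeI], THEN iffD2] allI)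
  then have "represented_by scale g V"
    unfolding represented_by_def using linV bijV by blast
  then show ?thesis using V by (rule that)
qed

end

section \<open>Stability of frames and of their operator representations\<close>

theorem proposition4p1:
  fixes smul :: "'k::rc_scalar \<Rightarrow> 'a::banach \<Rightarrow> 'a"
    and ip :: "'a \<Rightarrow> 'a \<Rightarrow> 'k"
    and f g :: "int \<Rightarrow> 'a"
    and T :: "'a \<Rightarrow> 'a"
    and lambda1 lambda2 :: real
  assumes "hilbert_space smul ip"
    and "represented_by smul f T"
    and "is_frame ip f"
    and "0 \<le> lambda1" "lambda1 < 1" "0 \<le> lambda2" "lambda2 < 1"
    and "\<And>(c :: int \<Rightarrow> 'k) F. finite F \<Longrightarrow>
      norm (\<Sum>k\<in>F. smul (c k) (f k - g k))
        \<le> lambda1 * norm (\<Sum>k\<in>F. smul (c k) (f k)) + lambda2 * norm (\<Sum>k\<in>F. smul (c k) (g k))"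
  shows "is_frame ip g \<and>
    (\<exists>V. represented_by smul g V \<and>
      (bounded_op_on (module.span smul (range f)) T \<longrightarrow>
       bounded_op_on (module.span smul (range g)) V))"
proof -
  interpret hilbert_space smul ip by (rule assms(1))
  let ?G = "graph_pairs smul f g"
  \<comment> \<open>Taking the maximum makes the hypothesis symmetric in the two sums, so each
    estimate can be used in both directions.\<close>
  define l where "l = max lambda1 lambda2"
  have l: "0 \<le> l" "l < 1" using assms(4-7) by (auto simp: l_def)
  have close: "norm (x - z) \<le> l * (norm x + norm z)" if xz: "(x, z) \<in> ?G" for x z
  proof -
    obtain c F where F: "finite F" "x = (\<Sum>k\<in>F. smul (c k) (f k))" "z = (\<Sum>k\<in>F. smul (c k) (g k))"
      using xz unfolding graph_pairs_def by blast
    have "norm (x - z) \<le> lambda1 * norm x + lambda2 * norm z"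
      using assms(8)[OF F(1), of c] unfolding F(2,3) by (simp add: scale_right_diff_distrib sum_subtractf)
    also have "\<dots> \<le> l * norm x + l * norm z"
      by (intro add_mono mult_right_mono) (auto simp: l_def)
    finally show ?thesis by (simp add: distrib_left)
  qed
  \<comment> \<open>Solving \<open>norm z - norm x \<le> l * (norm x + norm z)\<close> for
    \<open>norm z\<close> gives this constant, and symmetry gives it for
    \<open>norm x\<close>.\<close>
  define K where "K = (1 + l) / (1 - l)"
  have K: "0 < K" using l by (simp add: K_def)
  have Kz: "norm z \<le> K * norm x" if "(x, z) \<in> ?G" for x z
    using close[OF that] norm_triangle_ineq2[of z x] l
    by (simp add: K_def field_simps norm_minus_commute)
  have Kx: "norm x \<le> K * norm z" if "(x, z) \<in> ?G" for x z
    using close[OF that] norm_triangle_ineq2[of x z] l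
    by (simp add: K_def field_simps)
  have frame: "is_frame ip g"
    using assms(3) l close K Kz Kx by (rule is_frame_perturbed)
  have "x = 0 \<longleftrightarrow> z = 0" if "(x, z) \<in> ?G" for x z
    using Kz[OF that] Kx[OF that] by auto
  then obtain V where V: "represented_by smul g V"
    and TV: "\<And>x z. (x, z) \<in> ?G \<Longrightarrow> (T x, V z) \<in> ?G"
    using represented_by_transfer[OF assms(2)] by metis
  have "bounded_op_on (span (range g)) V" if bdd: "bounded_op_on (span (range f)) T"
  proof -
    obtain C where C: "\<And>x. x \<in> span (range f) \<Longrightarrow> norm (T x) \<le> C * norm x"
      using bdd unfolding bounded_op_on_def by blast
    \<comment> \<open>The product of the bounds of U, T and the inverse of U. The absolute value is
      there because \<open>bounded_op_on\<close> allows a negative constant.\<close>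
    have "norm (V z) \<le> (K * \<bar>C\<bar> * K) * norm z" if z: "z \<in> span (range g)" for z
    proof -
      obtain x where x: "(x, z) \<in> ?G"
        using z in_span_iff_graph_pairs[of z g f] graph_pairs_swap[of _ z smul f g] by blast
      have "norm (V z) \<le> K * norm (T x)" using Kz[OF TV[OF x]] .
      also have "\<dots> \<le> K * (\<bar>C\<bar> * norm x)"
      proof (rule mult_left_mono)
        have "norm (T x) \<le> C * norm x" using C x in_span_iff_graph_pairs[of x f g] by blast
        also have "\<dots> \<le> \<bar>C\<bar> * norm x" by (rule mult_right_mono) auto
        finally show "norm (T x) \<le> \<bar>C\<bar> * norm x" .
      qed (use K in simp)
      also have "\<dots> \<le> K * (\<bar>C\<bar> * (K * norm z))"
        using Kx[OF x] K by (intro mult_left_mono) auto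
      finally show ?thesis by (simp add: mult.assoc)
    qed
    then show ?thesis unfolding bounded_op_on_def by blast
  qed
  then show ?thesis using frame V by blast
qed

end
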